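(* Let $d$ be an integer with $d>2$. Then there is no permutation $\pi$ of $\{1,2,\ldots,d\}$ such that $\chi_d(x_1,x_2,\ldots,x_d)=s_d(x_{\pi(1)},x_{\pi(2)},\ldots,x_{\pi(d)})$ for all $(x_1,\ldots,x_d)\in\mathbb{N}^d$. That is, $\chi_d$ cannot be obtained by permuting the arguments of $s_d$.
   Context: $\mathbb{N}$ denotes the set of non-negative integers. For each positive integer $d$, Skolem's function is $s_d(x_1,\ldots,x_d)=\sum_{i=1}^d\binom{x_1+x_2+\cdots+x_i+i-1}{i}$, and Chowla's function is $\chi_d(x_1,\ldots,x_d)=\binom{x_1+\cdots+x_d+d}{d}-1-\sum_{i=1}^{d-1}\binom{x_{i+1}+\cdots+x_d+d-i-1}{d-i}$. Both are bijections from $\mathbb{N}^d$ to $\mathbb{N}$ (known facts). *)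

theory Defs
  imports Complex_Main "HOL-Combinatorics.Permutations"
begin

text \<open>A point \<open>(x\<^sub>1, \<dots>, x\<^sub>d)\<close> of \<open>\<nat>\<^sup>d\<close> is represented by a function \<open>x :: nat \<Rightarrow> nat\<close>,
  of which only the values \<open>x 1, \<dots>, x d\<close> matter.\<close>

definition skolem :: "nat \<Rightarrow> (nat \<Rightarrow> nat) \<Rightarrow> nat" where
  "skolem d x = (\<Sum>i = 1..d. ((\<Sum>j = 1..i. x j) + i - 1) choose i)"

text \<open>The outer differences are taken in \<open>int\<close> to avoid truncated subtraction; those inside the
  binomial coefficients (here and above) are never truncated, because \<open>1 \<le> i\<close>, and here
  \<open>i \<le> d - 1\<close>.\<close>

definition chowla :: "nat \<Rightarrow> (nat \<Rightarrow> nat) \<Rightarrow> int" where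
  "chowla d x =
     int (((\<Sum>j = 1..d. x j) + d) choose d) - 1
     - (\<Sum>i = 1..d - 1. int (((\<Sum>j = i + 1..d. x j) + d - i - 1) choose (d - i)))"

end

theory Submission
  imports Defs
begin

text \<open>Both functions are evaluated at multiples of unit vectors. At the unit vector with a one in
  position \<open>k\<close> both have the value \<open>d + 1 - k\<close>, so \<open>\<pi>\<close> would have to fix every position, in particular
  position \<open>2\<close>. At the vector \<open>(0, 2, 0, \<dots>, 0)\<close> however, Skolem's function is \<open>2\<close> below, and Chowla's
  function is \<open>d\<close> below, their common value at \<open>(2, 0, \<dots>, 0)\<close>.\<close>

lemma sum_single_interval:
  fixes a b k c :: nat
  shows "(\<Sum>j = a..b. if j = k then c else 0) = (if a \<le> k \<and> k \<le> b then c else 0)"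
  by (simp add: sum.delta)

text \<open>For \<open>i < k\<close> the partial sum is 0, so the term is
  \<open>(i - 1) choose i = 0\<close>.\<close>

lemma skolem_single:
  assumes "1 \<le> k" "k \<le> d"
  shows "skolem d (\<lambda>i. if i = k then c else 0) = (\<Sum>i = k..d. (c + i - 1) choose i)"
proof -
  have "skolem d (\<lambda>i. if i = k then c else 0) =
      (\<Sum>i = 1..d. if k \<le> i then (c + i - 1) choose i else 0)"
    unfolding skolem_def sum_single_interval using assms
    by (intro sum.cong) auto
  also have "\<dots> = (\<Sum>i = k..d. (c + i - 1) choose i)"
    using assms by (intro sum.mono_neutral_cong_right) auto
  finally show ?thesis .
qed

text \<open>Only the tail starting at \<open>i + 1 = 2\<close> contains position 2; for
  \<open>2 \<le> i \<le> d - 1\<close> the term is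
  \<open>(d - i - 1) choose (d - i) = 0\<close>.\<close>

lemma chowla_single_second:
  assumes "2 \<le> d"
  shows "chowla d (\<lambda>i. if i = 2 then c else 0) =
    int ((c + d) choose d) - 1 - int ((c + d - 2) choose (d - 1))"
proof -
  have "(\<Sum>i = 1..d - 1.
      int (((\<Sum>j = i + 1..d. if j = 2 then c else 0) + d - i - 1) choose (d - i))) =
      (\<Sum>i = 1..d - 1. if i = 1 then int ((c + d - 2) choose (d - 1)) else 0)"
    unfolding sum_single_interval using assms
    by (intro sum.cong) (auto intro!: arg_cong[where f = "\<lambda>n. n choose _"])
  also have "\<dots> = int ((c + d - 2) choose (d - 1))"
    using assms by (subst sum.delta) auto
  finally show ?thesis
    unfolding chowla_def sum_single_interval using assms by simp
qed

text \<open>The 3 supplies the missing 1 + 2 of the triangular number 1 + ... + (d + 1).\<close>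

lemma sum_Suc_from_2: "2 \<le> d \<Longrightarrow> (\<Sum>i = 2..d. i + 1) + 3 = (d + 2) choose 2"
  by (induction d rule: dec_induct) (simp_all add: choose_two numeral_2_eq_2)

theorem theorem1:
  fixes d :: nat
  assumes "d > 2"
  shows "\<not> (\<exists>\<pi>. \<pi> permutes {1..d} \<and>
           (\<forall>x :: nat \<Rightarrow> nat. chowla d x = int (skolem d (\<lambda>i. x (\<pi> i)))))"
proof
  assume "\<exists>\<pi>. \<pi> permutes {1..d} \<and>
           (\<forall>x :: nat \<Rightarrow> nat. chowla d x = int (skolem d (\<lambda>i. x (\<pi> i))))"
  then obtain \<pi> where \<pi>: "\<pi> permutes {1..d}"
    and eq: "\<And>x :: nat \<Rightarrow> nat. chowla d x = int (skolem d (\<lambda>i. x (\<pi> i)))"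
    by blast
  obtain k where k: "k \<in> {1..d}" "\<pi> k = 2"
    using permutes_image[OF \<pi>] assms by (metis atLeastAtMost_iff imageE less_imp_le one_le_numeral)
  \<comment> \<open>Composing with \<open>\<pi>\<close> thus moves the entry \<open>c\<close> from
    position 2 to position \<open>k\<close>.\<close>
  have iff: "\<pi> i = 2 \<longleftrightarrow> i = k" for i
    using permutes_inj[OF \<pi>] k(2) by (metis injD)
  have vals: "int ((c + d) choose d) - 1 - int ((c + d - 2) choose (d - 1)) =
      int (\<Sum>i = k..d. (c + i - 1) choose i)" for c
    using eq[of "\<lambda>i. if i = 2 then c else 0"] k(1) assms
    by (simp add: iff skolem_single chowla_single_second)
  \<comment> \<open>At \<open>c = 1\<close> the left side is \<open>d - 1\<close>, and the right
    side is a sum of \<open>d + 1 - k\<close> ones.\<close>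
  have "k = 2"
    using vals[of 1] k(1) assms by (simp add: of_nat_diff)
  have "(d + 2) choose d = (d + 2) choose 2"
    using binomial_symmetric[of 2 "d + 2"] by simp
  moreover have "d choose (d - 1) = d"
    using binomial_symmetric[of 1 d] assms by simp
  ultimately have "(d + 2) choose 2 = (\<Sum>i = 2..d. i + 1) + 1 + d"
    using vals[of 2] \<open>k = 2\<close> by (simp add: add.commute del: of_nat_sum)
  \<comment> \<open>Comparing the two sums gives \<open>d + 1 = 3\<close>, against
    \<open>d > 2\<close>.\<close>
  with sum_Suc_from_2[of d] assms show False
    by simp
qed

end
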